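(* Let $d\ge2$, $\epsilon\in(0,1]$, and let $\nu$ be a probability measure on $\mathrm{U}(d)$ which is an exact unitary $t$-design with $$t\ge 5\frac{d^{5/2}}{\epsilon}\,\tau(\epsilon,d),\qquad \tau(\epsilon,d)=\log\!\left(\tfrac{6C}{\epsilon}\right)^{1/2}\sqrt{\tfrac{1}{32}\log\!\left(\tfrac{6C}{\epsilon}\right)^{1/2}+\log\!\left(\tfrac{d}{\epsilon}\log\!\left(\tfrac{6C}{\epsilon}\right)^{1/2}\right)},$$ where $C=5\pi$. Then the set of unitary channels $\{\mathcal{V}: V\in\mathrm{supp}(\nu)\}$ is an $\epsilon$-net in $\mathcal{U}(d)$ with respect to the distance $\mathrm{D}$.
   Context: $\mathcal{U}(d)$ is the set of unitary channels $\rho\mapsto U\rho U^\dagger$ on $\mathbb{C}^d$; $\mathcal{V}$ denotes the channel of the unitary $V$. $\mathrm{D}(\mathcal{U},\mathcal{V})=\min_{\varphi\in[0,2\pi)}\|U-e^{i\varphi}V\|_\infty$ (operator norm). A subset $S\subset\mathcal{U}(d)$ is an $\epsilon$-net if for every $\mathcal{U}\in\mathcal{U}(d)$ there is $\mathcal{V}\in S$ with $\mathrm{D}(\mathcal{U},\mathcal{V})\le\epsilon$. $\nu$ is an exact $t$-design if $\int\mathrm{d}\nu(U)\,G(U)=\int\mathrm{d}\mu(U)\,G(U)$ for every function $G(U)=\mathrm{tr}(A\,U^{\otimes t}\otimes\bar U^{\otimes t})$, $A$ an operator on $(\mathbb{C}^d)^{\otimes 2t}$, where $\mu$ is the Haar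 probability measure on $\mathrm{U}(d)$. $\log$ is the natural logarithm. *)

theory Defs
  imports "HOL-Probability.Probability"
begin

definition cadjoint :: "complex^'n^'n \<Rightarrow> complex^'n^'n" where
  "cadjoint A = (\<chi> i j. cnj (A $ j $ i))"

definition unitary :: "complex^'n^'n \<Rightarrow> bool" where
  "unitary U \<longleftrightarrow> U ** cadjoint U = mat 1 \<and> cadjoint U ** U = mat 1"

definition unitary_group :: "(complex^'n^'n) set" where
  "unitary_group = {U. unitary U}"

definition opnorm :: "complex^'n^'n \<Rightarrow> real" where
  "opnorm A = onorm (\<lambda>x. A *v x)"

definition cscale :: "complex \<Rightarrow> complex^'n^'n \<Rightarrow> complex^'n^'n" where
  "cscale c A = (\<chi> i j. c * A $ i $ j)"

definition chan_dist :: "complex^'n^'n \<Rightarrow> complex^'n^'n \<Rightarrow> real" where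
  "chan_dist U V = (INF \<phi>\<in>{0..<2*pi}. opnorm (U - cscale (exp (\<i> * complex_of_real \<phi>)) V))"

definition prob_on_unitary :: "(complex^'n^'n) measure \<Rightarrow> bool" where
  "prob_on_unitary \<nu> \<longleftrightarrow> prob_space \<nu> \<and> sets \<nu> = sets borel \<and> emeasure \<nu> unitary_group = 1"

definition haar :: "(complex^'n^'n) measure \<Rightarrow> bool" where
  "haar \<mu> \<longleftrightarrow> prob_on_unitary \<mu> \<and>
     (\<forall>U. unitary U \<longrightarrow> (\<forall>S\<in>sets borel. emeasure \<mu> ((\<lambda>V. U ** V) -` S) = emeasure \<mu> S))"

text \<open>Multi-indices for (C^d)^{\<otimes> 2t}: functions {..<2t} \<rightarrow> 'n.\<close>
definition multi_idx :: "nat \<Rightarrow> (nat \<Rightarrow> 'n) set" where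
  "multi_idx t = PiE {..<2*t} (\<lambda>_. UNIV)"

text \<open>Matrix entry (a,b) of U^{\<otimes> t} \<otimes> conj(U)^{\<otimes> t}.\<close>
definition tensor_entry :: "nat \<Rightarrow> complex^'n^'n \<Rightarrow> (nat \<Rightarrow> 'n) \<Rightarrow> (nat \<Rightarrow> 'n) \<Rightarrow> complex" where
  "tensor_entry t U a b =
     (\<Prod>k<t. U $ a k $ b k) * (\<Prod>k<t. cnj (U $ a (t + k) $ b (t + k)))"

text \<open>G_A(U) = tr(A (U^{\<otimes> t} \<otimes> conj(U)^{\<otimes> t})), with A given by its matrix entries.\<close>
definition design_fun :: "nat \<Rightarrow> ((nat \<Rightarrow> 'n) \<Rightarrow> (nat \<Rightarrow> 'n) \<Rightarrow> complex) \<Rightarrow> complex^'n^'n \<Rightarrow> complex" where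
  "design_fun t A U = (\<Sum>a\<in>multi_idx t. \<Sum>b\<in>multi_idx t. A a b * tensor_entry t U b a)"

definition exact_t_design :: "nat \<Rightarrow> (complex^'n^'n) measure \<Rightarrow> bool" where
  "exact_t_design t \<nu> \<longleftrightarrow> prob_on_unitary \<nu> \<and>
     (\<exists>\<mu>. haar \<mu> \<and> (\<forall>A. (\<integral>U. design_fun t A U \<partial>\<nu>) = (\<integral>U. design_fun t A U \<partial>\<mu>)))"

definition msupp :: "(complex^'n^'n) measure \<Rightarrow> (complex^'n^'n) set" where
  "msupp \<nu> = {x. \<forall>S. open S \<longrightarrow> x \<in> S \<longrightarrow> emeasure \<nu> S > 0}"

definition eps_net :: "real \<Rightarrow> (complex^'n^'n) set \<Rightarrow> bool" where
  "eps_net \<epsilon> S \<longleftrightarrow> (\<forall>U. unitary U \<longrightarrow> (\<exists>V\<in>S. chan_dist U V \<le> \<epsilon>))"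

definition tau :: "real \<Rightarrow> real \<Rightarrow> real" where
  "tau \<epsilon> d = (let C = 5 * pi; L = sqrt (ln (6 * C / \<epsilon>)) in
     L * sqrt (L / 32 + ln (d / \<epsilon> * L)))"

end

theory Submission
  imports Defs
begin

text \<open>
  Suppose no point of the support of \<open>\<nu>\<close> is \<open>\<epsilon>\<close>-close to \<open>U\<close>. Bounding the operator norm by the Frobenius
  norm, \<open>h = |tr (U\<^sup>* V)| < a = d - \<epsilon>\<^sup>2 / 2\<close> for \<open>\<nu>\<close>-almost every \<open>V\<close>. With the Chebyshev polynomial \<open>T\<close> of
  degree \<open>n \<le> t / 2\<close> and a second threshold \<open>b = d - R\<^sup>2 / 2 < a\<close>, the polynomial
  \<open>p = (T (2 h\<^sup>2 / b\<^sup>2 - 1) + 1) (T (2 h\<^sup>2 / a\<^sup>2 - 1) - 1)\<close> has degree at most \<open>t\<close> in \<open>h\<^sup>2\<close> and is nonpositive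
  for \<open>h \<le> a\<close>, so its \<open>\<nu>\<close>-integral is nonpositive. Its Haar integral is the same, but it is positive:
  the second factor is exponentially large on the ball of radius \<open>\<epsilon> / 2\<close>, the first one makes the region
  \<open>h < b\<close> negligible, and packing in the real vector space of matrices, of dimension \<open>2 d\<^sup>2\<close>, bounds the Haar
  measure of a ball of radius \<open>R\<close> by that of a ball of radius \<open>r\<close> times the power of \<open>1 + 2 R / r\<close> with
  exponent \<open>2 d\<^sup>2\<close>. The choice \<open>R\<^sup>2 = \<epsilon>\<^sup>2 (1 + ln (2 d / \<epsilon>))\<close> balances the two factors; the second factor
  alone would cost a full \<open>ln d\<close> in the degree, which exceeds \<open>\<tau>\<close> for large \<open>d\<close>.
\<close>

subsection \<open>Chebyshev polynomials\<close>

fun cheb :: "nat \<Rightarrow> real poly" where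
  "cheb 0 = 1"
| "cheb (Suc 0) = [:0, 1:]"
| "cheb (Suc (Suc n)) = [:0, 2:] * cheb (Suc n) - cheb n"

lemma degree_cheb: "degree (cheb n) \<le> n"
proof (induction n rule: cheb.induct)
  case (3 n)
  have "degree ([:0, 2:] * cheb (Suc n)) \<le> Suc (Suc n)"
    using degree_mult_le[of "[:0, 2::real:]" "cheb (Suc n)"] 3 by simp
  then show ?case
    using 3 by (simp add: degree_diff_le)
qed simp_all

lemma poly_cheb_cos: "poly (cheb n) (cos x) = cos (real n * x)"
proof (induction n rule: cheb.induct)
  case (3 n)
  have "cos (real (Suc (Suc n)) * x) + cos (real n * x) = 2 * cos x * cos (real (Suc n) * x)"
    using cos_add[of "real (Suc n) * x" x] cos_diff[of "real (Suc n) * x" x]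
    by (simp add: algebra_simps)
  then show ?case using 3 by (simp add: algebra_simps)
qed simp_all

lemma poly_cheb_cosh: "poly (cheb n) (cosh x) = cosh (real n * (x::real))"
proof (induction n rule: cheb.induct)
  case (3 n)
  have "cosh (real (Suc (Suc n)) * x) + cosh (real n * x) = 2 * cosh x * cosh (real (Suc n) * x)"
    using cosh_add[of "real (Suc n) * x" x] cosh_diff[of "real (Suc n) * x" x]
    by (simp add: algebra_simps)
  then show ?case using 3 by (simp add: algebra_simps)
qed simp_all

lemma abs_poly_cheb_le_1:
  assumes "\<bar>z\<bar> \<le> 1" shows "\<bar>poly (cheb n) z\<bar> \<le> 1"
  using poly_cheb_cos[of n "arccos z"] assms by simp

text \<open>On [1, \<infinity>) every point is a \<open>cosh\<close>, and there the polynomial acts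
  by multiplying the nonnegative hyperbolic argument by n, which preserves order.\<close>

lemma poly_cheb_mono:
  assumes "1 \<le> z" "z \<le> w" shows "poly (cheb n) z \<le> poly (cheb n) w"
proof -
  have "arcosh z \<le> arcosh w"
    using assms arcosh_real_strict_mono[of z w] by (metis order_le_less)
  moreover have "0 \<le> arcosh z" using assms by simp
  ultimately have "real n * arcosh z \<le> real n * arcosh w" "0 \<le> real n * arcosh z"
    by (auto intro: mult_left_mono)
  then have "cosh (real n * arcosh z) \<le> cosh (real n * arcosh w)"
    by (simp add: cosh_real_nonneg_le_iff)
  then show ?thesis
    using poly_cheb_cosh[of n "arcosh z"] poly_cheb_cosh[of n "arcosh w"] assms by simp
qed

lemma poly_cheb_ge_1: "1 \<le> z \<Longrightarrow> 1 \<le> poly (cheb n) z"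
  using poly_cheb_mono[of 1 z n] poly_cheb_cosh[of n 0] by simp

lemma cosh_le_1_plus_square:
  fixes u :: real assumes "0 \<le> u" "u \<le> 1" shows "cosh u \<le> 1 + u\<^sup>2"
proof -
  have "exp u \<le> 1 + u + u\<^sup>2" using assms by (intro exp_bound)
  moreover have "exp (-u) \<le> 1 - u + u\<^sup>2"
  proof -
    \<comment> \<open>The product is 1 + u^3.\<close>
    have "1 \<le> (1 - u + u\<^sup>2) * (1 + u)"
      using assms by (simp add: algebra_simps power2_eq_square)
    also have "\<dots> \<le> (1 - u + u\<^sup>2) * exp u"
      using exp_ge_add_one_self[of u] assms by (intro mult_left_mono) auto
    finally show ?thesis by (simp add: exp_minus field_simps)
  qed
  ultimately show ?thesis by (simp add: cosh_def)
qed

text \<open>Here 2 w^2 - 1 is at least cosh (2 u), where the polynomial takes the value cosh (2 n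
  u). The excess of w over 1 enters as u^2, so a small excess yields a growth rate of the order of
  its square root.\<close>

lemma poly_cheb_lower:
  fixes u w :: real
  assumes "0 \<le> u" "u \<le> 1" "1 + u\<^sup>2 \<le> w"
  shows "exp (2 * real n * u) / 2 \<le> poly (cheb n) (2 * w\<^sup>2 - 1)"
proof -
  have "cosh u \<le> w" using cosh_le_1_plus_square assms by force
  then have "(cosh u)\<^sup>2 \<le> w\<^sup>2" by (intro power_mono) auto
  then have "cosh (2 * u) \<le> 2 * w\<^sup>2 - 1"
    using cosh_square_eq[of u] by (simp add: cosh_double)
  then have "poly (cheb n) (cosh (2 * u)) \<le> poly (cheb n) (2 * w\<^sup>2 - 1)"
    by (intro poly_cheb_mono) (auto simp: cosh_real_ge_1)
  moreover have "exp (2 * real n * u) / 2 \<le> cosh (real n * (2 * u))"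
    by (simp add: cosh_def mult_ac)
  ultimately show ?thesis by (simp add: poly_cheb_cosh)
qed

subsection \<open>Haar measure of balls\<close>

text \<open>Volume comparison: the balls of radius r/2 around the points of S are disjoint and lie
  in the ball of radius R + r/2 around c.\<close>

lemma card_separated_le:
  fixes S :: "'a::euclidean_space set"
  assumes S: "finite S" "S \<subseteq> cball c R" and r: "0 < r" and R: "0 \<le> R"
    and sep: "\<And>x y. x \<in> S \<Longrightarrow> y \<in> S \<Longrightarrow> x \<noteq> y \<Longrightarrow> r \<le> dist x y"
  shows "real (card S) \<le> (1 + 2 * R / r) ^ DIM('a)"
proof -
  let ?n = "DIM('a)"
  have disj: "disjoint_family_on (\<lambda>x. ball x (r/2)) S"
    unfolding disjoint_family_on_def
  proof (intro ballI impI)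
    fix x y assume "x \<in> S" "y \<in> S" "x \<noteq> y"
    then have "r \<le> dist x y" by (rule sep)
    then show "ball x (r/2) \<inter> ball y (r/2) = {}"
      by (intro disjoint_ballI) simp
  qed
  have sub: "(\<Union>x\<in>S. ball x (r/2)) \<subseteq> ball c (R + r/2)"
  proof safe
    fix x y assume "x \<in> S" "y \<in> ball x (r/2)"
    then show "y \<in> ball c (R + r/2)"
      using S(2) dist_triangle[of c y x] by (force simp: subset_eq)
  qed
  have "real (card S) * (unit_ball_vol ?n * (r/2) ^ ?n) = (\<Sum>x\<in>S. measure lborel (ball x (r/2)))"
    using r by (simp add: content_ball)
  also have "\<dots> = measure lborel (\<Union>x\<in>S. ball x (r/2))"
    using S(1) disj by (intro measure_finite_Union[symmetric]) (auto simp: emeasure_ball r less_imp_le)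
  also have "\<dots> \<le> measure lborel (ball c (R + r/2))"
    using sub r R by (intro measure_mono_fmeasurable) (auto intro!: sets.finite_UN S(1) simp: fmeasurable_def emeasure_ball)
  also have "\<dots> = unit_ball_vol ?n * (R + r/2) ^ ?n"
    using r R by (simp add: content_ball)
  finally have "unit_ball_vol ?n * (real (card S) * (r/2) ^ ?n) \<le> unit_ball_vol ?n * (R + r/2) ^ ?n"
    by (simp add: mult_ac)
  then have "real (card S) * (r/2) ^ ?n \<le> (R + r/2) ^ ?n"
    by (subst (asm) mult_le_cancel_left_pos) (simp_all add: unit_ball_vol_pos)
  then have "real (card S) \<le> (R + r/2) ^ ?n / (r/2) ^ ?n"
    using r by (simp add: pos_le_divide_eq)
  also have "\<dots> = ((R + r/2) / (r/2)) ^ ?n" by (rule power_divide[symmetric])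
  also have "(R + r/2) / (r/2) = 1 + 2 * R / r" using r by (simp add: field_simps)
  finally show ?thesis .
qed

text \<open>The Hilbert-Schmidt product tr(U^* V) in entries. It is a linear form in V, and its real
  part is the inner product that induces the Frobenius norm.\<close>

definition hsp :: "complex^'n^'n \<Rightarrow> complex^'n^'n \<Rightarrow> complex" where
  "hsp U V = (\<Sum>i\<in>UNIV. \<Sum>j\<in>UNIV. cnj (U $ i $ j) * V $ i $ j)"

lemma inner_eq_Re_hsp: "inner U V = Re (hsp U V)"
  by (simp add: inner_vec_def inner_complex_def hsp_def)

lemma hsp_unitary:
  fixes V :: "complex^'n^'n"
  assumes "unitary V" shows "hsp V V = of_nat CARD('n)"
proof -
  have "hsp V V = trace (cadjoint V ** V)"
    unfolding hsp_def by (subst sum.swap) (simp add: trace_def matrix_matrix_mult_def cadjoint_def)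
  also have "\<dots> = of_nat CARD('n)"
    using assms by (simp add: unitary_def trace_I)
  finally show ?thesis .
qed

lemma hsp_cscale_right: "hsp U (cscale c V) = c * hsp U V"
  by (simp add: hsp_def cscale_def sum_distrib_left mult_ac)

lemma hsp_cscale_left: "hsp (cscale c U) V = cnj c * hsp U V"
  by (simp add: hsp_def cscale_def sum_distrib_left mult_ac)

text \<open>Left translation by \<open>cadjoint W\<close> moves the centre W to the identity; this
  is how Haar invariance enters.\<close>

lemma hsp_cadjoint_mult: "hsp (mat 1) (cadjoint W ** V) = hsp W V"
proof -
  have "hsp (mat 1) (cadjoint W ** V) = (\<Sum>i\<in>UNIV. \<Sum>j\<in>UNIV. if i = j then (cadjoint W ** V) $ i $ j else 0)"
    unfolding hsp_def by (intro sum.cong refl) (simp add: mat_def)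
  also have "\<dots> = (\<Sum>i\<in>UNIV. \<Sum>k\<in>UNIV. cnj (W $ k $ i) * V $ k $ i)"
    by (simp add: matrix_matrix_mult_def cadjoint_def)
  also have "\<dots> = hsp W V"
    unfolding hsp_def by (rule sum.swap)
  finally show ?thesis .
qed

lemma cadjoint_cadjoint: "cadjoint (cadjoint A) = A"
  by (simp add: cadjoint_def vec_eq_iff)

lemma unitary_cadjoint: "unitary U \<Longrightarrow> unitary (cadjoint U)"
  by (simp add: unitary_def cadjoint_cadjoint)

lemma unitary_mat_1: "unitary (mat 1 :: complex^'n^'n)"
proof -
  have "cadjoint (mat 1 :: complex^'n^'n) = mat 1"
    by (auto simp: cadjoint_def mat_def vec_eq_iff)
  then show ?thesis by (simp add: unitary_def)
qed

text \<open>Unimodular factors leave both squared norms at d. With the best phases the cross term is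
  twice the modulus of \<open>hsp U V\<close>, so for s \<ge> 0 the condition
  \<open>d - s\<^sup>2 / 2 \<le> cmod (hsp U V)\<close> means Frobenius distance at most s up to a
  phase. The thresholds below have this form.\<close>

lemma norm_diff_phases:
  fixes U V :: "complex^'n^'n"
  assumes "unitary U" "unitary V" "cmod a = 1" "cmod b = 1"
  shows "(norm (cscale a U - cscale b V))\<^sup>2 = 2 * real CARD('n) - 2 * Re (cnj a * b * hsp U V)"
proof -
  have "a * (cnj a * x) = x" "b * (cnj b * x) = x" for x
    using assms by (simp_all add: complex_norm_square[symmetric] flip: mult.assoc)
  then have "Re (hsp (cscale a U) (cscale a U)) = real CARD('n)" "Re (hsp (cscale b V) (cscale b V)) = real CARD('n)"
    using assms by (simp_all only: hsp_cscale_left hsp_cscale_right hsp_unitary mult.left_commute[of "cnj _"]) simp_all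
  moreover have "Re (hsp (cscale a U) (cscale b V)) = Re (cnj a * b * hsp U V)"
    by (simp add: hsp_cscale_left hsp_cscale_right algebra_simps)
  ultimately show ?thesis
    unfolding power2_norm_eq_inner inner_diff_left inner_diff_right inner_commute[of "cscale b V" "cscale a U"]
    by (simp add: inner_eq_Re_hsp)
qed

text \<open>The argument of \<open>cnj z\<close> cancels that of z and lies in the half-open
  interval over which \<open>chan_dist\<close> takes its infimum.\<close>

lemma obtain_phase:
  obtains \<phi> where "0 \<le> \<phi>" "\<phi> < 2 * pi" "exp (\<i> * complex_of_real \<phi>) * z = complex_of_real (cmod z)"
proof
  let ?\<phi> = "Arg2pi (cnj z)"
  show "0 \<le> ?\<phi>" "?\<phi> < 2 * pi" by (auto simp: Arg2pi_ge_0 Arg2pi_lt_2pi)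
  have "cnj z = complex_of_real (cmod z) * exp (\<i> * complex_of_real ?\<phi>)"
    using Arg2pi_eq[of "cnj z"] by (metis complex_mod_cnj)
  then have "cmod z * (exp (\<i> * complex_of_real ?\<phi>) * z) = cnj z * z"
    by (simp add: mult_ac)
  also have "\<dots> = complex_of_real (cmod z) * complex_of_real (cmod z)"
    by (metis complex_norm_square mult.commute of_real_power power2_eq_square)
  finally show "exp (\<i> * complex_of_real ?\<phi>) * z = complex_of_real (cmod z)"
    by (cases "z = 0") auto
qed

section \<open>Channel distance against Hilbert-Schmidt overlap\<close>

lemma norm_matrix_vector_mult_le:
  fixes A :: "complex^'n^'m"
  shows "norm (A *v x) \<le> norm A * norm x"
proof -
  have "norm ((A *v x) $ i) \<le> norm (A $ i) * norm x" for i
  proof -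
    have "norm ((A *v x) $ i) \<le> (\<Sum>j\<in>UNIV. \<bar>norm (A $ i $ j)\<bar> * \<bar>norm (x $ j)\<bar>)"
      unfolding matrix_vector_mult_def by (auto intro!: order_trans[OF norm_sum] simp: norm_mult)
    also have "\<dots> \<le> norm (A $ i) * norm x"
      unfolding norm_vec_def by (rule L2_set_mult_ineq)
    finally show ?thesis .
  qed
  then have "norm (A *v x) \<le> L2_set (\<lambda>i. norm (A $ i) * norm x) UNIV"
    unfolding norm_vec_def[of "A *v x"] by (intro L2_set_mono) auto
  also have "\<dots> = norm A * norm x"
    unfolding norm_vec_def[of A] by (simp add: L2_set_left_distrib)
  finally show ?thesis .
qed

lemma opnorm_le_norm: "opnorm A \<le> norm A"
  unfolding opnorm_def by (intro onorm_le norm_matrix_vector_mult_le)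

lemma opnorm_nonneg: "0 \<le> opnorm A"
proof -
  have "bounded_linear ((*v) A)"
    using norm_matrix_vector_mult_le[of A]
    by (intro bounded_linear_intro[where K="norm A"] matrix_vector_right_distrib)
       (auto simp: vec_eq_iff matrix_vector_mult_def scaleR_sum_right mult.commute)
  then show ?thesis unfolding opnorm_def by (rule onorm_pos_le)
qed

lemma cscale_1: "cscale 1 U = U"
  by (simp add: cscale_def vec_eq_iff)

text \<open>The phase that makes \<open>hsp U V\<close> nonnegative is one candidate for the
  infimum, and the operator norm is at most the Frobenius norm. Hence a large distance forces a
  small overlap.\<close>

lemma chan_dist_le:
  fixes U V :: "complex^'n^'n"
  assumes "unitary U" "unitary V"
  shows "chan_dist U V \<le> sqrt (2 * real CARD('n) - 2 * cmod (hsp U V))"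
proof -
  obtain \<phi> where \<phi>: "0 \<le> \<phi>" "\<phi> < 2 * pi"
      "exp (\<i> * complex_of_real \<phi>) * hsp U V = complex_of_real (cmod (hsp U V))"
    by (rule obtain_phase)
  have "chan_dist U V \<le> opnorm (U - cscale (exp (\<i> * complex_of_real \<phi>)) V)"
    unfolding chan_dist_def using \<phi> by (intro cINF_lower bdd_belowI2[where m=0] opnorm_nonneg) auto
  also have "\<dots> \<le> norm (U - cscale (exp (\<i> * complex_of_real \<phi>)) V)"
    by (rule opnorm_le_norm)
  also have "\<dots> = sqrt (2 * real CARD('n) - 2 * cmod (hsp U V))"
    using norm_diff_phases[OF assms, of 1 "exp (\<i> * complex_of_real \<phi>)"] \<phi>(3)
    by (intro real_sqrt_unique[symmetric]) (auto simp: cscale_1)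
  finally show ?thesis .
qed

lemma cmod_hsp_le:
  fixes U V :: "complex^'n^'n"
  assumes "unitary U" "unitary V"
  shows "cmod (hsp U V) \<le> real CARD('n)"
proof -
  obtain \<phi> where \<phi>: "exp (\<i> * complex_of_real \<phi>) * hsp U V = complex_of_real (cmod (hsp U V))"
    using obtain_phase by blast
  have "0 \<le> (norm (cscale 1 U - cscale (exp (\<i> * complex_of_real \<phi>)) V))\<^sup>2" by simp
  also have "\<dots> = 2 * real CARD('n) - 2 * Re (cnj 1 * exp (\<i> * complex_of_real \<phi>) * hsp U V)"
    by (intro norm_diff_phases assms) simp_all
  also have "\<dots> = 2 * real CARD('n) - 2 * cmod (hsp U V)"
    using \<phi> by (simp only: complex_cnj_one mult_1 Re_complex_of_real)
  finally show ?thesis by simp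
qed

lemma continuous_on_hsp [continuous_intros]: "continuous_on S (hsp U)"
  unfolding hsp_def by (intro continuous_intros)

lemma closed_hsp_superlevel: "closed {V. c \<le> cmod (hsp W V)}"
  by (intro closed_Collect_le continuous_intros)

section \<open>Haar measure under translation and covering\<close>

lemma AE_unitary:
  fixes \<nu> :: "(complex^'n^'n) measure"
  assumes "prob_on_unitary \<nu>" shows "AE V in \<nu>. unitary V"
proof -
  interpret prob_space \<nu> using assms by (simp add: prob_on_unitary_def)
  have "prob unitary_group = 1"
    using assms by (simp add: prob_on_unitary_def measure_def)
  from AE_prob_1[OF this] show ?thesis by (simp add: unitary_group_def)
qed

lemma haar_measure_hsp:
  assumes "haar \<mu>" "unitary W"
  shows "measure \<mu> {V. c \<le> cmod (hsp W V)} = measure \<mu> {V. c \<le> cmod (hsp (mat 1) V)}"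
proof -
  have "{V. c \<le> cmod (hsp W V)} = (\<lambda>V. cadjoint W ** V) -` {V. c \<le> cmod (hsp (mat 1) V)}"
    by (auto simp: hsp_cadjoint_mult)
  moreover have "{V. c \<le> cmod (hsp (mat 1) V)} \<in> sets borel"
    using closed_hsp_superlevel borel_closed by blast
  ultimately show ?thesis
    using assms(1) unitary_cadjoint[OF assms(2)] unfolding haar_def measure_def by metis
qed

text \<open>A maximal r-separated subset S of the larger ball covers its unitaries by balls of
  radius r. By invariance these have equal measure, and packing in real dimension 2 d^2 limits the
  size of S.\<close>

lemma haar_measure_doubling:
  fixes \<mu> :: "(complex^'n^'n) measure"
  assumes haar: "haar \<mu>" and r: "0 < r" and R: "0 \<le> R"
  defines "d \<equiv> real CARD('n)"
  shows "measure \<mu> {V. d - R\<^sup>2 / 2 \<le> cmod (hsp (mat 1) V)}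
    \<le> (1 + 2 * R / r) ^ (2 * CARD('n)\<^sup>2) * measure \<mu> {V. d - r\<^sup>2 / 2 \<le> cmod (hsp (mat 1) V)}"
proof -
  interpret prob_space \<mu> using haar by (simp add: haar_def prob_on_unitary_def)
  have sets: "sets \<mu> = sets borel" using haar by (simp add: haar_def prob_on_unitary_def)
  have meas [measurable]: "{V. c \<le> cmod (hsp W V)} \<in> sets \<mu>" for c W
    unfolding sets using closed_hsp_superlevel borel_closed by blast
  define B where "B = (1 + 2 * R / r) ^ (2 * CARD('n)\<^sup>2)"
  txt \<open>Separation is measured modulo phases: multiplying the points by suitable phases moves them into a
    Frobenius ball around \<open>mat 1\<close> while keeping them separated.\<close>
  define sep where "sep S \<longleftrightarrow> finite S \<and> S \<subseteq> {V. unitary V \<and> d - R\<^sup>2 / 2 \<le> cmod (hsp (mat 1) V)} \<and>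
    (\<forall>U\<in>S. \<forall>V\<in>S. U \<noteq> V \<longrightarrow> cmod (hsp U V) < d - r\<^sup>2 / 2)" for S :: "(complex^'n^'n) set"
  have card_le: "real (card S) \<le> B" if S: "sep S" for S
  proof -
    have "\<exists>c. cmod c = 1 \<and> c * hsp (mat 1) V = complex_of_real (cmod (hsp (mat 1) V))" for V :: "complex^'n^'n"
      using obtain_phase[of "hsp (mat 1) V"] by (metis norm_exp_i_times)
    then obtain c where c: "cmod (c V) = 1" "c V * hsp (mat 1) V = complex_of_real (cmod (hsp (mat 1) V))"
      for V :: "complex^'n^'n" by metis
    let ?f = "\<lambda>V. cscale (c V) V"
    have far: "r \<le> dist (?f U) (?f V)" if UV: "U \<in> S" "V \<in> S" "U \<noteq> V" for U V
    proof -
      have "Re (cnj (c U) * c V * hsp U V) \<le> cmod (cnj (c U) * c V * hsp U V)"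
        by (rule complex_Re_le_cmod)
      also have "\<dots> = cmod (hsp U V)" by (simp add: norm_mult c)
      also have "\<dots> \<le> d - r\<^sup>2 / 2" using S UV by (force simp: sep_def)
      finally have "r\<^sup>2 \<le> (norm (?f U - ?f V))\<^sup>2"
        using S UV by (subst norm_diff_phases) (auto simp: sep_def c d_def)
      then show ?thesis unfolding dist_norm by (rule power2_le_imp_le) simp
    qed
    have "?f ` S \<subseteq> cball (mat 1) R"
    proof safe
      fix V assume V: "V \<in> S"
      have "(norm (cscale 1 (mat 1) - ?f V))\<^sup>2 \<le> R\<^sup>2"
        using S V by (subst norm_diff_phases) (auto simp: sep_def c unitary_mat_1 d_def)
      then show "?f V \<in> cball (mat 1) R"
        unfolding mem_cball dist_norm cscale_1 using R by (rule power2_le_imp_le)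
    qed
    moreover have "inj_on ?f S"
      using far r by (intro inj_onI) (metis dist_self linorder_not_le)
    moreover have "finite S" using S by (simp add: sep_def)
    ultimately have "real (card S) \<le> (1 + 2 * R / r) ^ DIM(complex^'n^'n)"
      using card_separated_le[of "?f ` S" "mat 1" R r] r R far by (auto simp: card_image)
    then show ?thesis by (simp add: B_def power2_eq_square mult_ac)
  qed
  \<comment> \<open>Packing bounds the size of separated sets, so one of greatest cardinality
    exists; the empty set shows that there are any.\<close>
  have "\<exists>S. sep S \<and> (\<forall>S'. sep S' \<longrightarrow> card S' \<le> card S)"
  proof (rule ex_has_greatest_nat[where k = "{}" and b = "nat \<lceil>B\<rceil> + 1"])
    show "\<forall>S'. sep S' \<longrightarrow> card S' < nat \<lceil>B\<rceil> + 1"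
    proof (intro allI impI)
      fix S' assume "sep S'"
      then have "real (card S') \<le> B" by (rule card_le)
      then show "card S' < nat \<lceil>B\<rceil> + 1" by linarith
    qed
  qed (simp add: sep_def)
  then obtain S where S: "sep S" and max: "\<And>S'. sep S' \<Longrightarrow> card S' \<le> card S" by blast
  have fin: "finite S" using S by (simp add: sep_def)
  have cover: "\<exists>U\<in>S. d - r\<^sup>2 / 2 \<le> cmod (hsp U V)"
    if V: "unitary V" "d - R\<^sup>2 / 2 \<le> cmod (hsp (mat 1) V)" for V
  proof (rule ccontr)
    assume "\<not> ?thesis"
    then have less: "cmod (hsp U V) < d - r\<^sup>2 / 2" if "U \<in> S" for U using that by force
    have sym: "cmod (hsp V U) = cmod (hsp U V)" for U
    proof -
      have "hsp V U = cnj (hsp U V)" by (simp add: hsp_def mult.commute)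
      then show ?thesis by simp
    qed
    \<comment> \<open>\<open>hsp V V\<close> equals d, which is above the threshold, so V is close
      to itself. Adding V to S then contradicts maximality.\<close>
    have "V \<notin> S" using less[of V] V(1) hsp_unitary[of V] by (auto simp: d_def)
    moreover have "sep (insert V S)"
      unfolding sep_def
    proof (intro conjI ballI impI)
      fix U U' assume "U \<in> insert V S" "U' \<in> insert V S" "U \<noteq> U'"
      then show "cmod (hsp U U') < d - r\<^sup>2 / 2"
        using S less[of U] less[of U'] sym[of U'] by (auto simp: sep_def)
    qed (use S V in \<open>auto simp: sep_def\<close>)
    ultimately show False using max[of "insert V S"] fin by simp
  qed
  have "measure \<mu> {V. d - R\<^sup>2 / 2 \<le> cmod (hsp (mat 1) V)}
      \<le> measure \<mu> (\<Union>U\<in>S. {V. d - r\<^sup>2 / 2 \<le> cmod (hsp U V)})"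
  proof (rule finite_measure_mono_AE)
    show "AE V in \<mu>. V \<in> {V. d - R\<^sup>2 / 2 \<le> cmod (hsp (mat 1) V)} \<longrightarrow> V \<in> (\<Union>U\<in>S. {V. d - r\<^sup>2 / 2 \<le> cmod (hsp U V)})"
      using AE_unitary[of \<mu>] haar by (rule_tac AE_mp) (auto simp: haar_def intro!: AE_I2 dest: cover)
  qed (use fin in \<open>auto intro!: sets.finite_UN\<close>)
  also have "\<dots> \<le> (\<Sum>U\<in>S. measure \<mu> {V. d - r\<^sup>2 / 2 \<le> cmod (hsp U V)})"
    using fin by (intro finite_measure_subadditive_finite) auto
  also have "\<dots> = (\<Sum>U\<in>S. measure \<mu> {V. d - r\<^sup>2 / 2 \<le> cmod (hsp (mat 1) V)})"
    using S haar by (intro sum.cong refl haar_measure_hsp) (auto simp: sep_def)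
  also have "\<dots> = real (card S) * measure \<mu> {V. d - r\<^sup>2 / 2 \<le> cmod (hsp (mat 1) V)}" by simp
  also have "\<dots> \<le> B * measure \<mu> {V. d - r\<^sup>2 / 2 \<le> cmod (hsp (mat 1) V)}"
    by (intro mult_right_mono card_le S) simp
  finally show ?thesis by (simp add: B_def)
qed

subsection \<open>Functions integrated exactly by designs\<close>

text \<open>Agreement is asked on unitaries only, so that the relation \<open>hsp V V = d\<close>
  may be used to raise the degree.\<close>

definition design_class :: "nat \<Rightarrow> (complex^'n^'n \<Rightarrow> complex) set" where
  "design_class t = {f. \<exists>A. \<forall>U. unitary U \<longrightarrow> f U = design_fun t A U}"

lemma design_class_cong:
  assumes "g \<in> design_class t" "\<And>U. unitary U \<Longrightarrow> f U = g U" shows "f \<in> design_class t"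
  using assms by (auto simp: design_class_def)

lemma design_class_0: "(\<lambda>U. 0) \<in> design_class t"
  unfolding design_class_def
  by (rule CollectI, rule exI[of _ "\<lambda>_ _. 0"]) (simp add: design_fun_def)

lemma design_class_add:
  assumes "f \<in> design_class t" "g \<in> design_class t" shows "(\<lambda>U. f U + g U) \<in> design_class t"
proof -
  obtain A B where "\<And>U. unitary U \<Longrightarrow> f U = design_fun t A U" "\<And>U. unitary U \<Longrightarrow> g U = design_fun t B U"
    using assms by (auto simp: design_class_def)
  then show ?thesis
    unfolding design_class_def
    by (intro CollectI exI[of _ "\<lambda>a b. A a b + B a b"]) (simp add: design_fun_def sum.distrib ring_distribs)
qed

lemma design_class_scale:
  assumes "f \<in> design_class t" shows "(\<lambda>U. c * f U) \<in> design_class t"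
proof -
  obtain A where "\<And>U. unitary U \<Longrightarrow> f U = design_fun t A U"
    using assms by (auto simp: design_class_def)
  then show ?thesis
    unfolding design_class_def
    by (intro CollectI exI[of _ "\<lambda>a b. c * A a b"]) (simp add: design_fun_def sum_distrib_left mult.assoc)
qed

lemma design_class_sum:
  assumes "finite I" "\<And>i. i \<in> I \<Longrightarrow> f i \<in> design_class t"
  shows "(\<lambda>U. \<Sum>i\<in>I. f i U) \<in> design_class t"
  using assms by (induction I rule: finite_induct) (simp_all add: design_class_0 design_class_add)

lemma prod_lessThan_double:
  fixes f :: "nat \<Rightarrow> 'a::comm_monoid_mult"
  shows "(\<Prod>k<2*t. f k) = (\<Prod>k<t. f k) * (\<Prod>k<t. f (t + k))"
proof -
  have "(\<Prod>k<2*t. f k) = (\<Prod>k<t. f k) * (\<Prod>k\<in>{t..<2*t}. f k)"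
    using prod.atLeastLessThan_concat[of 0 t "2 * t" f] by (simp add: lessThan_atLeast0)
  also have "(\<Prod>k\<in>{t..<2*t}. f k) = (\<Prod>k<t. f (t + k))"
    using prod.shift_bounds_nat_ivl[of f 0 t t] by (simp add: lessThan_atLeast0 add.commute mult_2)
  finally show ?thesis .
qed

text \<open>Multiplying out picks one matrix entry per factor, that is, a row multi-index and a
  column multi-index.\<close>

lemma design_class_linear_forms:
  fixes c c' :: "nat \<Rightarrow> complex^'n^'n"
  shows "(\<lambda>V. (\<Prod>k<t. hsp (c k) V) * (\<Prod>k<t. cnj (hsp (c' k) V))) \<in> design_class t"
proof -
  \<comment> \<open>Positions below t carry the plain factors, positions from t to 2 t - 1 the
    conjugated ones. The conjugate sits on c because \<open>hsp\<close> is conjugate-linear in its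
    first argument.\<close>
  define h where "h k = (if k < t then (\<lambda>i j. cnj (c k $ i $ j)) else (\<lambda>i j. c' (k - t) $ i $ j))" for k
  define e where "e V k = (if k < t then (\<lambda>i j. V $ i $ j) else (\<lambda>i j. cnj (V $ i $ j)))"
    for k and V :: "complex^'n^'n"
  \<comment> \<open>Row index b and column index a are interchanged because the trace pairs
    \<open>A a b\<close> with the entry (b, a) of the tensor power.\<close>
  define A where "A a b = (\<Prod>k<2*t. h k (b k) (a k))" for a b
  have "(\<Prod>k<t. hsp (c k) V) * (\<Prod>k<t. cnj (hsp (c' k) V)) = design_fun t A V" for V
  proof -
    have "(\<Prod>k<t. hsp (c k) V) * (\<Prod>k<t. cnj (hsp (c' k) V)) =
        (\<Prod>k<2*t. \<Sum>i\<in>UNIV. \<Sum>j\<in>UNIV. h k i j * e V k i j)"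
      by (simp add: prod_lessThan_double h_def e_def hsp_def)
    also have "\<dots> = (\<Sum>b\<in>multi_idx t. \<Prod>k<2*t. \<Sum>j\<in>UNIV. h k (b k) j * e V k (b k) j)"
      unfolding multi_idx_def by (subst prod_sum_PiE) auto
    also have "\<dots> = (\<Sum>b\<in>multi_idx t. \<Sum>a\<in>multi_idx t. \<Prod>k<2*t. h k (b k) (a k) * e V k (b k) (a k))"
      unfolding multi_idx_def by (subst prod_sum_PiE) auto
    also have "\<dots> = (\<Sum>a\<in>multi_idx t. \<Sum>b\<in>multi_idx t. \<Prod>k<2*t. h k (b k) (a k) * e V k (b k) (a k))"
      by (rule sum.swap)
    also have "\<dots> = design_fun t A V"
    proof -
      have "(\<Prod>k<2*t. e V k (b k) (a k)) = tensor_entry t V b a" for a b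
        by (simp add: prod_lessThan_double e_def tensor_entry_def)
      then show ?thesis by (simp add: design_fun_def A_def prod.distrib)
    qed
    finally show ?thesis .
  qed
  then show ?thesis by (auto simp: design_class_def)
qed

text \<open>On unitaries \<open>hsp V V / d = 1\<close>, which pads a polynomial of lower degree up to bidegree \<open>(t, t)\<close>.\<close>

lemma design_class_hsp_power:
  fixes W :: "complex^'n^'n"
  assumes "m \<le> t"
  shows "(\<lambda>V. (complex_of_real ((cmod (hsp W V))\<^sup>2)) ^ m) \<in> design_class t"
proof -
  define E where "E p = ((\<chi> i j. (if (i, j) = p then 1 else 0)) :: complex^'n^'n)" for p :: "'n \<times> 'n"
  \<comment> \<open>Each of the first m factors is the single term |tr(W^* V)|^2, with
    \<open>undefined\<close> as a dummy index. Each of the other t - m factors sums over all matrix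
    units \<open>E p\<close> and gives d.\<close>
  let ?P = "\<lambda>k. if k < m then {undefined} else (UNIV :: ('n \<times> 'n) set)"
  define c where "c k p = (if k < m then W else E p)" for k :: nat and p
  have hsp_E: "hsp (E (i, j)) V = V $ i $ j" for i j V
  proof -
    have "hsp (E (i, j)) V = (\<Sum>i'\<in>UNIV. \<Sum>j'\<in>UNIV. if i' = i \<and> j' = j then V $ i' $ j' else 0)"
      unfolding hsp_def E_def by (intro sum.cong refl) auto
    also have "\<dots> = (\<Sum>i'\<in>UNIV. if i' = i then V $ i' $ j else 0)"
      by (intro sum.cong refl) (auto simp: sum.delta)
    finally show ?thesis by simp
  qed
  have *: "(\<Sum>p\<in>?P k. hsp (c k p) V * cnj (hsp (c k p) V)) =
      (if k < m then complex_of_real ((cmod (hsp W V))\<^sup>2) else of_nat CARD('n))"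
    if V: "unitary V" for V k
  proof -
    have "(\<Sum>p\<in>UNIV. hsp (E p) V * cnj (hsp (E p) V)) = hsp V V"
      unfolding hsp_def[of V V] sum.cartesian_product UNIV_Times_UNIV
      by (intro sum.cong) (auto simp: hsp_E)
    then show ?thesis by (simp add: c_def hsp_unitary[OF V] complex_norm_square del: of_real_power)
  qed
  have eq: "(complex_of_real ((cmod (hsp W V))\<^sup>2)) ^ m =
      1 / of_nat CARD('n) ^ (t - m) * (\<Sum>g\<in>PiE {..<t} ?P. (\<Prod>k<t. hsp (c k (g k)) V) * (\<Prod>k<t. cnj (hsp (c k (g k)) V)))"
    if V: "unitary V" for V
  proof -
    have "(\<Sum>g\<in>PiE {..<t} ?P. (\<Prod>k<t. hsp (c k (g k)) V) * (\<Prod>k<t. cnj (hsp (c k (g k)) V)))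
        = (\<Prod>k<t. \<Sum>p\<in>?P k. hsp (c k p) V * cnj (hsp (c k p) V))"
      by (subst prod_sum_PiE) (auto simp: prod.distrib)
    also have "\<dots> = (\<Prod>k<t. if k < m then complex_of_real ((cmod (hsp W V))\<^sup>2) else of_nat CARD('n))"
      by (simp only: *[OF V])
    also have "\<dots> = complex_of_real ((cmod (hsp W V))\<^sup>2) ^ m * of_nat CARD('n) ^ (t - m)"
    proof -
      have "{..<t} \<inter> {k. k < m} = {..<m}" "{..<t} \<inter> - {k. k < m} = {m..<t}" using assms by auto
      then show ?thesis by (subst prod.If_cases) simp_all
    qed
    finally show ?thesis by simp
  qed
  show ?thesis
    by (rule design_class_cong[OF _ eq])
       (intro design_class_scale design_class_sum design_class_linear_forms finite_PiE; auto)
qed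

lemma design_class_poly:
  fixes W :: "complex^'n^'n"
  assumes "degree p \<le> t"
  shows "(\<lambda>V. complex_of_real (poly p ((cmod (hsp W V))\<^sup>2))) \<in> design_class t"
proof -
  have "complex_of_real (poly p ((cmod (hsp W V))\<^sup>2)) =
      (\<Sum>m\<le>degree p. complex_of_real (coeff p m) * complex_of_real ((cmod (hsp W V))\<^sup>2) ^ m)" for V
    by (simp add: poly_altdef)
  then show ?thesis
    using assms by (simp only:) (intro design_class_sum design_class_scale design_class_hsp_power; simp)
qed

lemma continuous_on_design_fun: "continuous_on S (design_fun t A)"
  unfolding design_fun_def tensor_entry_def by (intro continuous_intros)

lemma exact_t_design_integral_eq:
  fixes \<nu> :: "(complex^'n^'n) measure"
  assumes \<nu>: "prob_on_unitary \<nu>" and \<mu>: "prob_on_unitary \<mu>"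
    and eq: "\<And>A. (\<integral>U. design_fun t A U \<partial>\<nu>) = (\<integral>U. design_fun t A U \<partial>\<mu>)"
    and f: "f \<in> design_class t" and meas: "f \<in> borel_measurable borel"
  shows "(\<integral>U. f U \<partial>\<nu>) = (\<integral>U. f U \<partial>\<mu>)"
proof -
  obtain A where A: "\<And>U. unitary U \<Longrightarrow> f U = design_fun t A U"
    using f by (auto simp: design_class_def)
  have "(\<integral>U. f U \<partial>M) = (\<integral>U. design_fun t A U \<partial>M)" if M: "prob_on_unitary M" for M
  proof (rule integral_cong_AE)
    have sets: "sets M = sets borel" using M by (simp add: prob_on_unitary_def)
    show "f \<in> borel_measurable M" "design_fun t A \<in> borel_measurable M"
      using meas borel_measurable_continuous_onI[OF continuous_on_design_fun, of t A]
      by (simp_all add: measurable_cong_sets[OF sets refl])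
    show "AE U in M. f U = design_fun t A U"
      using AE_unitary[OF M] by eventually_elim (rule A)
  qed
  then show ?thesis using eq \<nu> \<mu> by simp
qed

text \<open>The complement of the support is the union of all open null sets; by the Lindelof
  property countably many of them suffice.\<close>

lemma AE_msupp:
  fixes \<nu> :: "(complex^'n^'n) measure"
  assumes "sets \<nu> = sets borel"
  shows "AE V in \<nu>. V \<in> msupp \<nu>"
proof -
  define F where "F = {S. open S \<and> emeasure \<nu> S = 0}"
  have "\<And>S. S \<in> F \<Longrightarrow> open S" by (simp add: F_def)
  then obtain F' where F': "F' \<subseteq> F" "countable F'" "\<Union>F' = \<Union>F"
    by (rule Lindelof)
  have "(\<Union>S\<in>F'. S) \<in> null_sets \<nu>"
    using F' assms by (intro null_sets_UN') (auto simp: F_def null_sets_def)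
  then have "\<Union>F \<in> null_sets \<nu>" using F' by simp
  then show ?thesis
    by (rule AE_I') (auto simp: F_def msupp_def not_gr_zero)
qed

subsection \<open>The test polynomial\<close>

text \<open>The variable is h^2. For positive a and b the shift +1 makes the first factor
  nonnegative for h \<ge> 0, and -1 makes the second nonpositive for 0 \<le> h \<le> a.\<close>

definition test_poly :: "nat \<Rightarrow> real \<Rightarrow> real \<Rightarrow> real poly" where
  "test_poly n a b = (pcompose (cheb n) [:- 1, 2 / b\<^sup>2:] + 1) * (pcompose (cheb n) [:- 1, 2 / a\<^sup>2:] - 1)"

lemma degree_test_poly: "degree (test_poly n a b) \<le> 2 * n"
proof -
  have "degree (pcompose (cheb n) [:- 1, 2 / c\<^sup>2:]) \<le> n" for c :: real
    using degree_cheb[of n] by (simp add: degree_pcompose)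
  then have "degree (pcompose (cheb n) [:- 1, 2 / b\<^sup>2:] + 1) \<le> n" "degree (pcompose (cheb n) [:- 1, 2 / a\<^sup>2:] - 1) \<le> n"
    by (auto intro!: degree_add_le degree_diff_le)
  then show ?thesis
    unfolding test_poly_def by (intro order_trans[OF degree_mult_le]) simp
qed

lemma poly_test_poly:
  "poly (test_poly n a b) (h\<^sup>2) =
    (poly (cheb n) (2 * (h / b)\<^sup>2 - 1) + 1) * (poly (cheb n) (2 * (h / a)\<^sup>2 - 1) - 1)"
  by (simp add: test_poly_def poly_pcompose power_divide algebra_simps)

lemma cheb_square_le_1:
  assumes "0 < a" "0 \<le> h" "h \<le> a"
  shows "\<bar>poly (cheb n) (2 * (h / a)\<^sup>2 - 1)\<bar> \<le> 1"
proof (rule abs_poly_cheb_le_1)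
  have "(h / a)\<^sup>2 \<le> 1" using assms by (intro power_le_one) auto
  then show "\<bar>2 * (h / a)\<^sup>2 - 1\<bar> \<le> 1" by (simp add: abs_le_iff)
qed

lemma cheb_square_mono:
  assumes "0 < a" "a \<le> h" "h \<le> k"
  shows "poly (cheb n) (2 * (h / a)\<^sup>2 - 1) \<le> poly (cheb n) (2 * (k / a)\<^sup>2 - 1)"
proof (rule poly_cheb_mono)
  show "1 \<le> 2 * (h / a)\<^sup>2 - 1" using assms one_le_power[of "h / a" 2] by simp
  show "2 * (h / a)\<^sup>2 - 1 \<le> 2 * (k / a)\<^sup>2 - 1"
    using assms by (simp add: power_mono divide_right_mono)
qed

lemma cheb_square_ge_1:
  assumes "0 < a" "a \<le> h" shows "1 \<le> poly (cheb n) (2 * (h / a)\<^sup>2 - 1)"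
  using assms one_le_power[of "h / a" 2] by (intro poly_cheb_ge_1) simp

lemma cheb_square_ge_minus_1:
  assumes "0 < a" "0 \<le> h" shows "- 1 \<le> poly (cheb n) (2 * (h / a)\<^sup>2 - 1)"
  using cheb_square_le_1[OF assms, of n] cheb_square_ge_1[OF assms(1), of h n] by (cases "h \<le> a") auto

lemma test_poly_nonpos:
  assumes "0 < b" "0 < a" "0 \<le> h" "h \<le> a"
  shows "poly (test_poly n a b) (h\<^sup>2) \<le> 0"
  unfolding poly_test_poly
  using cheb_square_ge_minus_1[of b h n] cheb_square_le_1[of a h n] assms
  by (intro mult_nonneg_nonpos) auto

text \<open>A step-function minorant. Below b the product is at least -4; on [b, a) the first factor
  is at most M + 1 and the second at least -2; on [a, c) the product is nonnegative; from c on both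
  factors have grown to at least M + 1 and Q - 1.\<close>

lemma test_poly_lower:
  fixes a b c h :: real and n :: nat
  assumes "0 < b" "b \<le> a" "a \<le> c" "0 \<le> h"
  defines "M \<equiv> poly (cheb n) (2 * (a / b)\<^sup>2 - 1)" and "Q \<equiv> poly (cheb n) (2 * (c / a)\<^sup>2 - 1)"
  shows "(M + 1) * (Q - 1) * indicator {c..} h - 2 * (M + 1) * indicator {b..} h - 4
    \<le> poly (test_poly n a b) (h\<^sup>2)"
proof -
  let ?Tb = "poly (cheb n) (2 * (h / b)\<^sup>2 - 1)" and ?Ta = "poly (cheb n) (2 * (h / a)\<^sup>2 - 1)"
  have M: "1 \<le> M" and Q: "1 \<le> Q"
    unfolding M_def Q_def using assms by (intro cheb_square_ge_1; simp)+
  have Tb: "- 1 \<le> ?Tb" using assms by (intro cheb_square_ge_minus_1) auto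
  consider "h < b" | "b \<le> h" "h < a" | "a \<le> h" "h < c" | "c \<le> h" by linarith
  then show ?thesis
  proof cases
    case 1
    then have "\<bar>?Tb\<bar> \<le> 1" "\<bar>?Ta\<bar> \<le> 1" using assms by (intro cheb_square_le_1; simp)+
    then have "(?Tb + 1) * (1 - ?Ta) \<le> 2 * 2" by (intro mult_mono) auto
    then show ?thesis using 1 assms by (simp add: poly_test_poly algebra_simps)
  next
    case 2
    then have "\<bar>?Ta\<bar> \<le> 1" using assms by (intro cheb_square_le_1; simp)
    moreover have "?Tb \<le> M" unfolding M_def using 2 assms by (intro cheb_square_mono) auto
    ultimately have "(?Tb + 1) * (1 - ?Ta) \<le> (M + 1) * 2" using M by (intro mult_mono) auto
    then show ?thesis using 2 assms by (simp add: poly_test_poly algebra_simps)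
  next
    case 3
    then have "1 \<le> ?Ta" using assms by (intro cheb_square_ge_1) auto
    then have "0 \<le> (?Tb + 1) * (?Ta - 1)" using Tb by (intro mult_nonneg_nonneg) auto
    then show ?thesis using 3 assms M by (simp add: poly_test_poly)
  next
    case 4
    have "M \<le> ?Tb" "Q \<le> ?Ta"
      unfolding M_def Q_def using 4 assms by (intro cheb_square_mono; simp)+
    then have "(M + 1) * (Q - 1) \<le> (?Tb + 1) * (?Ta - 1)"
      using M Q by (intro mult_mono) auto
    then show ?thesis using 4 assms M by (simp add: poly_test_poly)
  qed
qed

section \<open>Positivity of the Haar integral\<close>

lemma continuous_on_poly_hsp: "continuous_on S (\<lambda>V. poly p ((cmod (hsp U V))\<^sup>2))"
  by (intro continuous_intros)

text \<open>With G x the measure of the overlaps \<ge> x, the minorant integrates to (M+1)(Q-1) G c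
  - 2(M+1) G b - 4. The bound on Q and covering of the R-ball by r-balls make the first term at
  least 4(M+1) G b. Covering the whole group by R-balls bounds G b below, so the bound on M makes
  the remaining 2(M+1) G b exceed 4.\<close>

lemma haar_integral_test_poly_pos:
  fixes \<mu> :: "(complex^'n^'n) measure" and U :: "complex^'n^'n"
  assumes haar: "haar \<mu>" and U: "unitary U"
  defines "d \<equiv> real CARD('n)"
  assumes r: "0 < r" "r \<le> e" "e \<le> R" "R\<^sup>2 < 2 * d"
    and Q: "1 + 4 * (1 + 2 * R / r) ^ (2 * CARD('n)\<^sup>2)
      \<le> poly (cheb n) (2 * ((d - r\<^sup>2 / 2) / (d - e\<^sup>2 / 2))\<^sup>2 - 1)"
    and M: "2 * (1 + 2 * sqrt (2 * d) / R) ^ (2 * CARD('n)\<^sup>2)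
      < poly (cheb n) (2 * ((d - e\<^sup>2 / 2) / (d - R\<^sup>2 / 2))\<^sup>2 - 1) + 1"
  shows "0 < (\<integral>V. poly (test_poly n (d - e\<^sup>2 / 2) (d - R\<^sup>2 / 2)) ((cmod (hsp U V))\<^sup>2) \<partial>\<mu>)"
proof -
  interpret prob_space \<mu> using haar by (simp add: haar_def prob_on_unitary_def)
  have sets: "sets \<mu> = sets borel" and prob: "prob_on_unitary \<mu>"
    using haar by (auto simp: haar_def prob_on_unitary_def)
  have meas [measurable]: "{V. c \<le> cmod (hsp W V)} \<in> sets \<mu>" for c W
    unfolding sets using closed_hsp_superlevel borel_closed by blast
  define a b c where "a = d - e\<^sup>2 / 2" and "b = d - R\<^sup>2 / 2" and "c = d - r\<^sup>2 / 2"
  let ?p = "test_poly n a b"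
  let ?M = "poly (cheb n) (2 * (a / b)\<^sup>2 - 1)" and ?Q = "poly (cheb n) (2 * (c / a)\<^sup>2 - 1)"
  define A B where "A = (1 + 2 * R / r) ^ (2 * CARD('n)\<^sup>2)" and "B = (1 + 2 * sqrt (2 * d) / R) ^ (2 * CARD('n)\<^sup>2)"
  define G where "G x = prob {V. x \<le> cmod (hsp (mat 1) V)}" for x
  have order: "0 < b" "b \<le> a" "a \<le> c"
    using r by (auto simp: a_def b_def c_def power_mono)
  have "0 < R" using r by simp
  have GU: "prob {V. x \<le> cmod (hsp U V)} = G x" for x
    unfolding G_def by (rule haar_measure_hsp[OF haar U])
  have "G b \<le> A * G c"
    using haar_measure_doubling[OF haar r(1), of R] \<open>0 < R\<close> by (simp add: G_def A_def b_def c_def d_def)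
  \<comment> \<open>The radius \<open>sqrt (2 * d)\<close> puts the threshold at 0, so the larger
    ball is everything.\<close>
  have "1 \<le> B * G b"
  proof -
    have "G 0 = 1" using prob_space sets_eq_imp_space_eq[OF sets] by (simp add: G_def)
    then show ?thesis
      using haar_measure_doubling[OF haar \<open>0 < R\<close>, of "sqrt (2 * d)"]
      by (simp add: G_def B_def b_def d_def)
  qed
  have B: "1 \<le> B" unfolding B_def using \<open>0 < R\<close> by (intro one_le_power) (simp add: d_def)
  have int: "integrable \<mu> (\<lambda>V. poly ?p ((cmod (hsp U V))\<^sup>2))"
  proof -
    have "compact ((poly ?p) ` {0..d\<^sup>2})" by (intro compact_continuous_image continuous_intros) auto
    then obtain K where K: "\<And>x. x \<in> {0..d\<^sup>2} \<Longrightarrow> norm (poly ?p x) \<le> K"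
      using compact_imp_bounded by (force simp: bounded_iff)
    have "AE V in \<mu>. norm (poly ?p ((cmod (hsp U V))\<^sup>2)) \<le> K"
      using AE_unitary[OF prob]
      by eventually_elim (auto intro!: K power_mono simp: d_def cmod_hsp_le U simp del: real_norm_def)
    moreover have "(\<lambda>V. poly ?p ((cmod (hsp U V))\<^sup>2)) \<in> borel_measurable \<mu>"
      using borel_measurable_continuous_onI[OF continuous_on_poly_hsp, of ?p U]
      by (simp add: measurable_cong_sets[OF sets refl])
    ultimately show ?thesis by (rule integrable_const_bound)
  qed
  have ind: "indicator {x..} (cmod (hsp U V)) = indicat_real {V. x \<le> cmod (hsp U V)} V" for x V
    by (simp add: indicator_def)
  have int_ind [simp]: "integrable \<mu> (indicat_real {V. x \<le> cmod (hsp U V)})" for x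
    by (intro integrable_real_indicator) (simp_all add: emeasure_eq_measure)
  have "0 < 2 * (?M + 1) / B - 4"
    using M B by (simp add: B_def a_def b_def field_simps)
  also have "\<dots> \<le> 2 * (?M + 1) * G b - 4"
  proof -
    have "1 / B \<le> G b" using \<open>1 \<le> B * G b\<close> B by (simp add: field_simps)
    moreover have "0 \<le> ?M + 1" using cheb_square_ge_1[of b a n] order by simp
    ultimately have "2 * (?M + 1) * (1 / B) \<le> 2 * (?M + 1) * G b" by (intro mult_left_mono) auto
    then show ?thesis by simp
  qed
  also have "\<dots> \<le> (?M + 1) * (?Q - 1) * G c - 2 * (?M + 1) * G b - 4"
  proof -
    have "4 * G b \<le> 4 * A * G c" using \<open>G b \<le> A * G c\<close> by simp
    also have "\<dots> \<le> (?Q - 1) * G c"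
      using Q by (intro mult_right_mono) (simp_all add: A_def a_def c_def G_def)
    finally have "(?M + 1) * (4 * G b) \<le> (?M + 1) * ((?Q - 1) * G c)"
      using cheb_square_ge_1[of b a n] order by (intro mult_left_mono) auto
    then show ?thesis by (simp add: algebra_simps)
  qed
  also have "\<dots> = (\<integral>V. (?M + 1) * (?Q - 1) * indicator {c..} (cmod (hsp U V))
      - 2 * (?M + 1) * indicator {b..} (cmod (hsp U V)) - 4 \<partial>\<mu>)"
    unfolding ind by (simp add: prob_space GU)
  also have "\<dots> \<le> (\<integral>V. poly ?p ((cmod (hsp U V))\<^sup>2) \<partial>\<mu>)"
  proof (rule integral_mono[OF _ int])
    show "(?M + 1) * (?Q - 1) * indicator {c..} (cmod (hsp U V)) - 2 * (?M + 1) * indicator {b..} (cmod (hsp U V)) - 4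
        \<le> poly ?p ((cmod (hsp U V))\<^sup>2)" for V
      using order by (intro test_poly_lower) auto
  qed (unfold ind, simp)
  finally show ?thesis by (simp add: a_def b_def)
qed

subsection \<open>Choice of the radii\<close>

text \<open>Since exp 4 \<le> 81 \<le> 30 pi, the inner root L is at least 2. This yields the factor
  2 in front and 2 d / \<epsilon> inside the logarithm.\<close>

lemma tau_lower:
  assumes "2 \<le> d" "0 < \<epsilon>" "\<epsilon> \<le> 1"
  shows "2 * sqrt (ln (2 * d / \<epsilon>)) \<le> tau \<epsilon> d"
proof -
  define L where "L = sqrt (ln (6 * (5 * pi) / \<epsilon>))"
  have "exp (4::real) = exp 1 ^ 4" by (simp flip: exp_of_nat_mult)
  also have "\<dots> \<le> 3 ^ 4" by (intro power_mono exp_le) auto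
  also have "\<dots> \<le> 6 * (5 * pi)" using pi_gt3 by simp
  also have "\<dots> \<le> 6 * (5 * pi) / \<epsilon>" using assms by (simp add: field_simps)
  finally have "4 \<le> ln (6 * (5 * pi) / \<epsilon>)" using assms by (subst ln_ge_iff) auto
  then have L: "2 \<le> L" unfolding L_def by (intro real_le_rsqrt) simp
  have "2 * d / \<epsilon> \<le> d / \<epsilon> * L"
    using L assms by (simp add: field_simps)
  then have "ln (2 * d / \<epsilon>) \<le> ln (d / \<epsilon> * L)" using assms L by (subst ln_le_cancel_iff) auto
  then have "sqrt (ln (2 * d / \<epsilon>)) \<le> sqrt (L / 32 + ln (d / \<epsilon> * L))" using L by simp
  moreover have "0 \<le> ln (2 * d / \<epsilon>)" using assms by simp
  ultimately have "2 * sqrt (ln (2 * d / \<epsilon>)) \<le> L * sqrt (L / 32 + ln (d / \<epsilon> * L))"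
    using L by (intro mult_mono) auto
  then show ?thesis by (simp add: tau_def Let_def L_def)
qed

text \<open>Brings the ratio into the form 1 + u^2 expected by \<open>poly_cheb_lower\<close>, by
  enlarging the denominator d - e^2/2 to d.\<close>

lemma threshold_ratio:
  fixes d :: real
  assumes "r\<^sup>2 \<le> e\<^sup>2" "e\<^sup>2 < 2 * d"
  shows "1 + (e\<^sup>2 - r\<^sup>2) / (2 * d) \<le> (d - r\<^sup>2 / 2) / (d - e\<^sup>2 / 2)"
proof -
  have "0 < d" using assms zero_le_power2[of e] by linarith
  have "(e\<^sup>2 - r\<^sup>2) / 2 / d \<le> (e\<^sup>2 - r\<^sup>2) / 2 / (d - e\<^sup>2 / 2)"
    using assms \<open>0 < d\<close> by (intro divide_left_mono mult_pos_pos) auto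
  also have "\<dots> = (d - r\<^sup>2 / 2) / (d - e\<^sup>2 / 2) - 1"
    using assms by (simp add: field_simps)
  finally show ?thesis by (simp add: mult.commute)
qed

text \<open>With q^2 = ln (2 d / \<epsilon>), the inner radius \<epsilon>/2 gives a covering number
  at most exp (5 d^2 q) against a growth rate of order \<epsilon> / sqrt d. Covering the group costs
  exp (4 d^2 q^2), but there the rate is larger by a factor of order q. Both demand a degree of
  order d^(5/2) q / \<epsilon>.\<close>

lemma parameter_bounds:
  fixes N t :: nat and \<epsilon> :: real
  assumes N: "2 \<le> N" and \<epsilon>: "0 < \<epsilon>" "\<epsilon> \<le> 1"
    and t: "5 * real N powr (5/2) / \<epsilon> * tau \<epsilon> (real N) \<le> real t"
  defines "d \<equiv> real N" and "n \<equiv> t div 2"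
  defines "R \<equiv> \<epsilon> * sqrt (1 + ln (2 * d / \<epsilon>))"
  shows "\<epsilon> \<le> R" and "R\<^sup>2 < 2 * d"
    and "1 + 4 * (1 + 2 * R / (\<epsilon> / 2)) ^ (2 * N\<^sup>2)
      \<le> poly (cheb n) (2 * ((d - (\<epsilon> / 2)\<^sup>2 / 2) / (d - \<epsilon>\<^sup>2 / 2))\<^sup>2 - 1)"
    and "2 * (1 + 2 * sqrt (2 * d) / R) ^ (2 * N\<^sup>2)
      < poly (cheb n) (2 * ((d - \<epsilon>\<^sup>2 / 2) / (d - R\<^sup>2 / 2))\<^sup>2 - 1) + 1"
proof -
  define a l q where "a = 2 * d / \<epsilon>" and "l = ln a" and "q = sqrt l"
  have d: "2 \<le> d" using N by (simp add: d_def)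
  have a: "4 \<le> a" unfolding a_def using d \<epsilon> by (simp add: field_simps)
  have "4 / 3 \<le> ln (4::real)" using ln2_ge_two_thirds ln_realpow[of 2 2] by simp
  also have "\<dots> \<le> l" unfolding l_def using a by simp
  finally have l: "4 / 3 \<le> l" .
  have q2: "q\<^sup>2 = l" using l by (simp add: q_def)
  have q: "23/20 \<le> q" unfolding q_def using l by (intro real_le_rsqrt) (simp add: power2_eq_square)
  have l_le: "l \<le> a / 2"
    using ln_add_one_self_le_self[of "a / 2 - 1"] ln_le_minus_one[of 2] ln_div[of a 2] a
    by (simp add: l_def)
  have R: "R = \<epsilon> * sqrt (1 + l)" by (simp add: R_def l_def a_def)
  have R2: "R\<^sup>2 = \<epsilon>\<^sup>2 * (1 + l)" using l by (simp add: R power_mult_distrib)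
  show eR: "\<epsilon> \<le> R" using \<epsilon> l by (simp add: R)
  show R2d: "R\<^sup>2 < 2 * d"
  proof -
    have "R\<^sup>2 < \<epsilon>\<^sup>2 * a" unfolding R2 using l_le a \<epsilon> by (intro mult_strict_left_mono) auto
    also have "\<dots> = \<epsilon> * (2 * d)" using \<epsilon> by (simp add: a_def power2_eq_square)
    also have "\<dots> \<le> 1 * (2 * d)" using \<epsilon> d by (intro mult_right_mono) auto
    finally show ?thesis by simp
  qed
  have e2d: "\<epsilon>\<^sup>2 < 2 * d" using power_mono[OF eR, of 2] \<epsilon> R2d by simp
  have sd: "7/5 \<le> sqrt d" using d by (intro real_le_rsqrt) (simp add: power2_eq_square)

  \<comment> \<open>X is d^(5/2) q / \<epsilon>; the hypothesis on t with \<open>tau\<close>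
    replaced by its lower bound 2 q reads 10 X \<le> t.\<close>
  define X where "X = d\<^sup>2 * sqrt d * q / \<epsilon>"
  have "10 * X \<le> real t"
  proof -
    have "d powr (5/2) = d powr 2 * d powr (1/2)"
      unfolding powr_add[symmetric] by simp
    then have "d powr (5/2) = d\<^sup>2 * sqrt d"
      using d by (simp add: powr_half_sqrt)
    then have "10 * X = 5 * d powr (5/2) / \<epsilon> * (2 * q)" by (simp add: X_def)
    also have "\<dots> \<le> 5 * d powr (5/2) / \<epsilon> * tau \<epsilon> d"
      using tau_lower[OF d \<epsilon>] \<epsilon> by (intro mult_left_mono) (auto simp: q_def l_def a_def)
    finally show ?thesis using t by (simp add: d_def)
  qed
  moreover have "5 \<le> X"
  proof -
    have "5 \<le> (2\<^sup>2 * (7/5) * (23/20) :: real)" by simp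
    also have "\<dots> \<le> d\<^sup>2 * sqrt d * q" using d sd q by (intro mult_mono power_mono) auto
    also have "\<dots> \<le> X" unfolding X_def using \<epsilon> d q by (simp add: field_simps)
    finally show ?thesis .
  qed
  moreover have "real t \<le> 2 * real n + 1" unfolding n_def by linarith
  \<comment> \<open>Rounding gives n \<ge> 5 X - 1/2, and X \<ge> 5 absorbs the 1/2 into
    X/10.\<close>
  ultimately have n: "(49/10) * X \<le> real n" by linarith
  have n': "(49/5) * k * d\<^sup>2 * q \<le> 2 * real n * (k * \<epsilon> / sqrt d)" if "0 \<le> k" for k
  proof -
    have "(49/5) * k * d\<^sup>2 * q = 2 * ((49/10) * X) * (k * \<epsilon> / sqrt d)"
      using \<epsilon> d by (simp add: X_def)
    also have "\<dots> \<le> 2 * real n * (k * \<epsilon> / sqrt d)"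
      using n that \<epsilon> d by (intro mult_right_mono) auto
    finally show ?thesis .
  qed
  have d4: "4 \<le> d\<^sup>2" using power_mono[OF d, of 2] by simp

  show "1 + 4 * (1 + 2 * R / (\<epsilon> / 2)) ^ (2 * N\<^sup>2)
      \<le> poly (cheb n) (2 * ((d - (\<epsilon> / 2)\<^sup>2 / 2) / (d - \<epsilon>\<^sup>2 / 2))\<^sup>2 - 1)"
  proof -
    define A where "A = (1 + 2 * R / (\<epsilon> / 2)) ^ (2 * N\<^sup>2)"
    \<comment> \<open>For l \<ge> 4/3 one has 1 + l \<le> (7/4) l, and 1.33^2 exceeds 7/4.\<close>
    have "sqrt (1 + l) \<le> (133/100) * q"
    proof (rule real_le_lsqrt)
      show "1 + l \<le> ((133/100) * q)\<^sup>2" using l unfolding power_mult_distrib q2 by (simp add: power2_eq_square)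
    qed (use q in auto)
    moreover have "2 * R / (\<epsilon> / 2) = 4 * sqrt (1 + l)" using \<epsilon> by (simp add: R)
    ultimately have "1 + 2 * R / (\<epsilon> / 2) \<le> 1 + (133/25) * q" by simp
    also have "\<dots> \<le> 1 + (5/2) * q + ((5/2) * q)\<^sup>2 / 2"
    proof -
      have "(23/20) * q \<le> q * q" using q by (intro mult_right_mono) auto
      moreover have "((5/2) * q)\<^sup>2 = (25/4) * (q * q)" by (simp add: power2_eq_square)
      ultimately show ?thesis using q by linarith
    qed
    also have "\<dots> \<le> exp ((5/2) * q)" using q by (intro exp_lower_Taylor_quadratic) auto
    finally have "A \<le> exp ((5/2) * q) ^ (2 * N\<^sup>2)"
      unfolding A_def using eR \<epsilon> by (intro power_mono) auto
    also have "\<dots> = exp (5 * d\<^sup>2 * q)" by (simp add: d_def mult_ac flip: exp_of_nat_mult)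
    finally have A: "A \<le> exp (5 * d\<^sup>2 * q)" .
    have "1 \<le> A" unfolding A_def using eR \<epsilon> by (intro one_le_power) auto
    txt \<open>The slope \<open>30/49\<close> below satisfies \<open>(30/49)\<^sup>2 \<le> 3/8\<close> and \<open>49/5 * 30/49 = 6\<close>.\<close>
    have dq: "23/5 \<le> d\<^sup>2 * q" using mult_mono[OF d4 q] by simp
    \<comment> \<open>The 10 pays for 1 + 4 A \<le> 5 A and for the factor 1/2 in
      \<open>poly_cheb_lower\<close>, at the cost of raising the exponent from 5 to 6 times d^2
      q.\<close>
    have "10 \<le> 1 + d\<^sup>2 * q + (d\<^sup>2 * q)\<^sup>2 / 2"
    proof -
      have "(23/5) * (23/5) \<le> (d\<^sup>2 * q) * (d\<^sup>2 * q)" using dq by (intro mult_mono) auto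
      then show ?thesis using dq unfolding power2_eq_square[of "d\<^sup>2 * q"] by linarith
    qed
    also have "\<dots> \<le> exp (d\<^sup>2 * q)" using dq by (intro exp_lower_Taylor_quadratic) auto
    finally have "10 \<le> exp (d\<^sup>2 * q)" .
    then have "10 * A \<le> exp (d\<^sup>2 * q) * exp (5 * d\<^sup>2 * q)" using A \<open>1 \<le> A\<close> by (intro mult_mono) auto
    also have "\<dots> = exp (6 * d\<^sup>2 * q)" by (simp flip: exp_add)
    also have "\<dots> \<le> exp (2 * real n * ((30/49) * \<epsilon> / sqrt d))"
      using n'[of "(30/49)"] dq by (simp add: mult.assoc)
    finally have "1 + 4 * A \<le> exp (2 * real n * ((30/49) * \<epsilon> / sqrt d)) / 2"
      using \<open>1 \<le> A\<close> by simp
    also have "\<dots> \<le> poly (cheb n) (2 * ((d - (\<epsilon> / 2)\<^sup>2 / 2) / (d - \<epsilon>\<^sup>2 / 2))\<^sup>2 - 1)"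
    proof (rule poly_cheb_lower)
      show "(30/49) * \<epsilon> / sqrt d \<le> 1" using \<epsilon> sd by (subst divide_le_eq_1_pos) linarith+
      have "((30/49) * \<epsilon> / sqrt d)\<^sup>2 = (30/49)\<^sup>2 * (\<epsilon>\<^sup>2 / d)"
        using d by (simp add: power_mult_distrib power_divide)
      also have "\<dots> \<le> (3 / 8) * (\<epsilon>\<^sup>2 / d)"
        using d by (intro mult_right_mono) (auto simp: power2_eq_square)
      also have "\<dots> = (\<epsilon>\<^sup>2 - (\<epsilon> / 2)\<^sup>2) / (2 * d)" by (simp add: power2_eq_square field_simps)
      finally show "1 + ((30/49) * \<epsilon> / sqrt d)\<^sup>2 \<le> (d - (\<epsilon> / 2)\<^sup>2 / 2) / (d - \<epsilon>\<^sup>2 / 2)"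
        using threshold_ratio[of "\<epsilon> / 2" \<epsilon> d] e2d by (simp add: power_divide)
    qed (use \<epsilon> d in auto)
    finally show ?thesis by (simp add: A_def)
  qed

  show "2 * (1 + 2 * sqrt (2 * d) / R) ^ (2 * N\<^sup>2)
      < poly (cheb n) (2 * ((d - \<epsilon>\<^sup>2 / 2) / (d - R\<^sup>2 / 2))\<^sup>2 - 1) + 1"
  proof -
    define B where "B = (1 + 2 * sqrt (2 * d) / R) ^ (2 * N\<^sup>2)"
    have "sqrt (2 * d) \<le> d" using d by (intro real_le_lsqrt) (auto simp: power2_eq_square)
    then have "2 * sqrt (2 * d) / R \<le> 2 * d / \<epsilon>"
      using eR \<epsilon> d by (intro frac_le) auto
    then have "1 + 2 * sqrt (2 * d) / R \<le> 1 + a" by (simp add: a_def)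
    also have "\<dots> \<le> a\<^sup>2" 
    proof -
      have "4 * a \<le> a * a" using a by (intro mult_right_mono) auto
      then show ?thesis using a unfolding power2_eq_square by linarith
    qed
    also have "\<dots> = exp (2 * l)" using a by (simp add: l_def exp_double)
    finally have "B \<le> exp (2 * l) ^ (2 * N\<^sup>2)"
      unfolding B_def using eR \<epsilon> d by (intro power_mono) auto
    also have "\<dots> = exp (4 * (d\<^sup>2 * l))" by (simp add: d_def mult_ac flip: exp_of_nat_mult)
    finally have B: "B \<le> exp (4 * (d\<^sup>2 * l))" .
    have dl: "4 * (4 / 3) \<le> d\<^sup>2 * l" using d4 l by (intro mult_mono) auto
    have "4 \<le> exp (2 * (d\<^sup>2 * l))" using exp_ge_add_one_self[of "2 * (d\<^sup>2 * l)"] dl by linarith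
    then have "4 * B \<le> exp (2 * (d\<^sup>2 * l)) * exp (4 * (d\<^sup>2 * l))"
      using B eR \<epsilon> d by (intro mult_mono) (auto simp: B_def)
    also have "\<dots> = exp (6 * (d\<^sup>2 * l))" by (simp flip: exp_add)
    \<comment> \<open>The slope 7/10 satisfies 49/5 * 7/10 = 6.86 \<ge> 6, and its square 49/100 is
      below the 1/2 available from R^2 - \<epsilon>^2 = \<epsilon>^2 l.\<close>
    also have "\<dots> \<le> exp (2 * real n * ((7/10) * q * \<epsilon> / sqrt d))"
    proof -
      have "6 * (d\<^sup>2 * l) \<le> (343/50) * (d\<^sup>2 * l)" using dl by linarith
      also have "\<dots> = (49/5) * ((7/10) * q) * d\<^sup>2 * q" by (simp add: q2[symmetric] power2_eq_square)
      also have "\<dots> \<le> 2 * real n * ((7/10) * q * \<epsilon> / sqrt d)" using q by (intro n') simp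
      finally show ?thesis by simp
    qed
    finally have "2 * B < exp (2 * real n * ((7/10) * q * \<epsilon> / sqrt d)) / 2 + 1" by simp
    also have "exp (2 * real n * ((7/10) * q * \<epsilon> / sqrt d)) / 2 \<le>
        poly (cheb n) (2 * ((d - \<epsilon>\<^sup>2 / 2) / (d - R\<^sup>2 / 2))\<^sup>2 - 1)"
    proof (rule poly_cheb_lower)
      have "((7/10) * q * \<epsilon> / sqrt d)\<^sup>2 = (49/100) * (l * \<epsilon>\<^sup>2 / d)"
        using d by (simp add: power_mult_distrib power_divide q2)
      also have "\<dots> \<le> (1/2) * (l * \<epsilon>\<^sup>2 / d)" using l d by (intro mult_right_mono) auto
      also have "\<dots> = (R\<^sup>2 - \<epsilon>\<^sup>2) / (2 * d)" by (simp add: R2 algebra_simps)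
      finally have le: "((7/10) * q * \<epsilon> / sqrt d)\<^sup>2 \<le> (R\<^sup>2 - \<epsilon>\<^sup>2) / (2 * d)" .
      then show "1 + ((7/10) * q * \<epsilon> / sqrt d)\<^sup>2 \<le> (d - \<epsilon>\<^sup>2 / 2) / (d - R\<^sup>2 / 2)"
        using threshold_ratio[of \<epsilon> R d] R2d power_mono[OF eR, of 2] \<epsilon> by simp
      have "(R\<^sup>2 - \<epsilon>\<^sup>2) / (2 * d) \<le> 1\<^sup>2" using R2d d by (simp add: field_simps add_increasing2)
      with le have "((7/10) * q * \<epsilon> / sqrt d)\<^sup>2 \<le> 1\<^sup>2" by (rule order_trans)
      then show "(7/10) * q * \<epsilon> / sqrt d \<le> 1" by (rule power2_le_imp_le) simp
    qed (use \<epsilon> d q in auto)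
    finally show ?thesis by (simp add: B_def)
  qed
qed

section \<open>Contradiction from a unitary far from the support\<close>

theorem theorem2:
  fixes \<nu> :: "(complex^'n^'n) measure" and \<epsilon> :: real and t :: nat
  assumes "CARD('n) \<ge> 2"
    and "0 < \<epsilon>" and "\<epsilon> \<le> 1"
    and "exact_t_design t \<nu>"
    and "real t \<ge> 5 * real CARD('n) powr (5/2) / \<epsilon> * tau \<epsilon> (real CARD('n))"
  shows "eps_net \<epsilon> (msupp \<nu>)"
proof (rule ccontr)
  assume "\<not> eps_net \<epsilon> (msupp \<nu>)"
  then obtain U where U: "unitary U" and far: "\<And>V. V \<in> msupp \<nu> \<Longrightarrow> \<epsilon> < chan_dist U V"
    by (force simp: eps_net_def)
  from assms(4) obtain \<mu> where \<nu>: "prob_on_unitary \<nu>" and \<mu>: "haar \<mu>"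
    and eq: "\<And>A. (\<integral>U. design_fun t A U \<partial>\<nu>) = (\<integral>U. design_fun t A U \<partial>\<mu>)"
    by (auto simp: exact_t_design_def)
  define d where "d = real CARD('n)"
  define R where "R = \<epsilon> * sqrt (1 + ln (2 * d / \<epsilon>))"
  define a b where "a = d - \<epsilon>\<^sup>2 / 2" and "b = d - R\<^sup>2 / 2"
  note par = parameter_bounds[OF assms(1-3) assms(5), folded d_def, folded R_def]
  let ?f = "\<lambda>V. poly (test_poly (t div 2) a b) ((cmod (hsp U V))\<^sup>2)"
  have ba: "0 < b" "b \<le> a"
    using par(1,2) power_mono[OF par(1), of 2] assms(2) by (auto simp: a_def b_def)
  have "0 < (\<integral>V. ?f V \<partial>\<mu>)"
    unfolding a_def b_def d_def
    by (rule haar_integral_test_poly_pos[OF \<mu> U, where r = "\<epsilon> / 2"])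
       (use par assms in \<open>auto simp: d_def\<close>)
  moreover have "(\<integral>V. ?f V \<partial>\<nu>) \<le> 0"
  proof -
    have "sets \<nu> = sets borel" using \<nu> by (simp add: prob_on_unitary_def)
    \<comment> \<open>Almost every V is unitary and lies in the support, so its overlap with U is
      below a. Working with \<open>- ?f\<close> gives the sign of the integral without an
      integrability proof.\<close>
    from AE_msupp[OF this] AE_unitary[OF \<nu>] have "AE V in \<nu>. 0 \<le> - ?f V"
    proof eventually_elim
      case (elim V)
      have "\<epsilon> < sqrt (2 * d - 2 * cmod (hsp U V))"
        using far[OF elim(1)] chan_dist_le[OF U elim(2)] by (simp add: d_def)
      then have "\<epsilon>\<^sup>2 < 2 * d - 2 * cmod (hsp U V)"
        using assms(2) by (metis abs_of_pos real_sqrt_abs real_sqrt_less_iff)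
      then have "?f V \<le> 0" using ba by (intro test_poly_nonpos) (auto simp: a_def)
      then show ?case by simp
    qed
    then have "0 \<le> (\<integral>V. - ?f V \<partial>\<nu>)" by (rule integral_nonneg_AE)
    then show ?thesis by simp
  qed
  \<comment> \<open>The degree is at most 2 * (t div 2) \<le> t. The values are made complex to
    match \<open>design_fun\<close>.\<close>
  moreover have "(\<integral>V. complex_of_real (?f V) \<partial>\<nu>) = (\<integral>V. complex_of_real (?f V) \<partial>\<mu>)"
  proof (rule exact_t_design_integral_eq[OF \<nu> _ eq])
    show "prob_on_unitary \<mu>" using \<mu> by (simp add: haar_def)
    show "(\<lambda>V. complex_of_real (?f V)) \<in> design_class t"
      using degree_test_poly[of "t div 2" a b] by (intro design_class_poly) linarith
    show "(\<lambda>V. complex_of_real (?f V)) \<in> borel_measurable borel"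
      by (intro borel_measurable_continuous_onI continuous_intros)
  qed
  ultimately show False by simp
qed

end
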